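(* For every dimension $n$ there exists a constant $C$, depending only on $n$, such that the following holds. Let $Q\subset\mathbb R^n$ be a cube, $E\subset\mathbb R^n$ a measurable set, $k\in\mathbb N$ and $s\geq 0$ such that \[ \frac1{2^{(k+s)n}}\leq\frac{\mathcal L(Q\cap E)}{\mathcal L(Q)}\leq\frac12 . \] For $x\in Q$ let $A_k(x)=Q\cap B(x,2^{-k}\mathrm l(Q))\setminus B(x,2^{-k-1}\mathrm l(Q))$. Then \[ \biggl(\frac{\mathcal L(Q\cap E)}{\mathcal L(Q)}\biggr)^{\frac{n-1}n} \leq C\,2^{k+s}\,\frac1{\mathcal L(Q)}\int_Q\frac1{\mathcal L(A_k(x))}\int_{A_k(x)}|1_E(x)-1_E(y)|\,dy\,dx . \]
   Context: $\mathcal L$ is Lebesgue measure on $\mathbb R^n$, $1_E$ is the characteristic function of $E$, $B(x,r)$ is the Euclidean ball with center $x$ and radius $r$, and $\mathbb N=\{1,2,\dots\}$. A cube is a closed axis-parallel cube $[a_1,a_1+l]\times\dots\times[a_n,a_n+l]$ with side length $\mathrm l(Q)=l>0$. *)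

theory Defs
  imports "HOL-Analysis.Analysis"
begin

definition cube :: "real ^ 'n \<Rightarrow> real \<Rightarrow> (real ^ 'n) set" where
  "cube a l = cbox a (\<chi> i. a $ i + l)"

text \<open>The part of the cube \<open>cube a l\<close> in the dyadic annulus of scale \<open>k\<close> around \<open>x\<close>. The balls
  are open; closed ones would change the set only by a null set.\<close>

definition cube_annulus :: "real ^ 'n \<Rightarrow> real \<Rightarrow> nat \<Rightarrow> real ^ 'n \<Rightarrow> (real ^ 'n) set" where
  "cube_annulus a l k x =
     cube a l \<inter> ball x (2 powr (- real k) * l) - ball x (2 powr (- real k - 1) * l)"

end

theory Submission
  imports Defs
begin

text \<open>Divide the cube into a grid of \<open>N\<^sup>n\<close> cells whose side is a fixed fraction of \<open>2\<^sup>-\<^sup>k l\<close>, and let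
  \<open>d\<close> be the density of \<open>E\<close> in each cell. The annulus integral controls the probability
  \<open>d\<^sub>1 (1 - d\<^sub>2) + d\<^sub>2 (1 - d\<^sub>1)\<close> that independent random points of two cells are separated by \<open>E\<close>,
  summed over pairs of cells at distance about \<open>2\<^sup>-\<^sup>k l\<close>; going through a third cell, it also controls the
  sums over equal and over adjacent cells. Let \<open>F\<close> be the set of cells of density at least \<open>1/2\<close>. If a
  good part of \<open>E\<close> lies outside \<open>F\<close>, or if \<open>F\<close> fills most of the grid although \<open>E\<close> does not, then many
  cells are mixed and the sum over equal cells is large; the first case is the one that needs the parameter
  \<open>s\<close>. Otherwise a discrete isoperimetric inequality, which follows from the Loomis--Whitney
  inequality, gives many pairs of adjacent cells exactly one of which is in \<open>F\<close>.\<close>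

section \<open>The Loomis--Whitney inequality for finite sets\<close>

text \<open>Hoelder's inequality for \<open>card I\<close> factors with equal exponents, stated
  without roots. After each \<open>a i\<close> is divided by its sum over \<open>T\<close>, the
  arithmetic-geometric mean inequality bounds every \<open>x t\<close>, and these bounds add up. It
  serves to sum over slices in the proof of Loomis--Whitney.\<close>

lemma sum_power_le_prod_sum:
  fixes x :: "'t \<Rightarrow> real" and a :: "'i \<Rightarrow> 't \<Rightarrow> real"
  assumes "finite T" "finite I" "I \<noteq> {}" and c: "c \<ge> 0"
    and x: "\<And>t. t \<in> T \<Longrightarrow> x t \<ge> 0"
    and a: "\<And>i t. i \<in> I \<Longrightarrow> t \<in> T \<Longrightarrow> a i t \<ge> 0"
    and le: "\<And>t. t \<in> T \<Longrightarrow> x t ^ card I \<le> c * (\<Prod>i\<in>I. a i t)"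
  shows "(\<Sum>t\<in>T. x t) ^ card I \<le> c * (\<Prod>i\<in>I. \<Sum>t\<in>T. a i t)"
proof -
  define m where "m = card I"
  have m: "m > 0" using assms by (simp add: m_def card_gt_0_iff)
  define S where "S i = (\<Sum>t\<in>T. a i t)" for i
  have S0: "S i \<ge> 0" if "i \<in> I" for i
    unfolding S_def using a that by (simp add: sum_nonneg)
  show ?thesis
  proof (cases "\<exists>i\<in>I. S i = 0")
    \<comment> \<open>Normalising is impossible here, but \<open>a i\<close> then vanishes on
      \<open>T\<close> and forces every \<open>x t\<close> to be zero.\<close>
    case True
    then obtain i where i: "i \<in> I" "S i = 0" by blast
    have "x t = 0" if t: "t \<in> T" for t
    proof -
      have "a i t = 0"
        using i t a[OF i(1)] \<open>finite T\<close> by (simp add: S_def sum_nonneg_eq_0_iff)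
      then have "(\<Prod>i\<in>I. a i t) = 0" using i(1) \<open>finite I\<close> by auto
      then have "x t ^ m \<le> 0" using le[OF t] by (simp add: m_def)
      then show ?thesis using x[OF t] m
        by (metis order.antisym power_eq_0_iff zero_le_power)
    qed
    then have "(\<Sum>t\<in>T. x t) = 0" by simp
    then show ?thesis
      using m i \<open>finite I\<close> by (simp add: m_def[symmetric] zero_power S_def[symmetric] prod_zero_iff)
        (metis (no_types, lifting) prod_nonneg mult_nonneg_nonneg c S0)
  next
    case False
    then have Spos: "S i > 0" if "i \<in> I" for i using S0[OF that] that by force
    \<comment> \<open>\<open>R\<close> is the claimed bound after taking an \<open>m\<close>-th
      root. Each \<open>x t\<close> is at most \<open>R\<close> times the average of the shares
      \<open>a i t / S i\<close>, and these averages sum to 1 over \<open>T\<close>.\<close>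
    define R where "R = root m (c * (\<Prod>i\<in>I. S i))"
    have R0: "R \<ge> 0"
      unfolding R_def using c Spos by (intro real_root_ge_zero mult_nonneg_nonneg prod_nonneg) (auto intro: less_imp_le)
    have Rm: "R ^ m = c * (\<Prod>i\<in>I. S i)"
      unfolding R_def using m c S0 by (intro real_root_pow_pos2 mult_nonneg_nonneg prod_nonneg) auto
    have bound: "x t \<le> R * (\<Sum>i\<in>I. (a i t / S i) / m)" if t: "t \<in> T" for t
    proof -
      have n0: "(\<Prod>i\<in>I. a i t / S i) \<ge> 0"
        using a[OF _ t] S0 by (intro prod_nonneg) auto
      have "x t ^ m \<le> c * (\<Prod>i\<in>I. a i t)" using le[OF t] by (simp add: m_def)
      also have "(\<Prod>i\<in>I. a i t) = (\<Prod>i\<in>I. S i) * (\<Prod>i\<in>I. a i t / S i)"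
        unfolding prod.distrib[symmetric] using Spos by (intro prod.cong) (auto simp: less_imp_neq[symmetric])
      also have "c * ((\<Prod>i\<in>I. S i) * (\<Prod>i\<in>I. a i t / S i)) = R ^ m * (root m (\<Prod>i\<in>I. a i t / S i)) ^ m"
        using m n0 by (simp add: Rm)
      finally have "x t ^ m \<le> (R * root m (\<Prod>i\<in>I. a i t / S i)) ^ m"
        by (simp add: power_mult_distrib)
      then have "x t \<le> R * root m (\<Prod>i\<in>I. a i t / S i)"
        using m R0 n0 by (meson mult_nonneg_nonneg power_mono_iff real_root_ge_zero x[OF t])
      also have "root m (\<Prod>i\<in>I. a i t / S i) \<le> (\<Sum>i\<in>I. (a i t / S i) / m)"
        using arith_geom_mean[of I "\<lambda>i. a i t / S i"] a[OF _ t] S0 assms(2,3) m n0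
        by (simp add: m_def[symmetric] root_powr_inverse)
      finally show ?thesis using R0 by (simp add: mult_left_mono)
    qed
    have "(\<Sum>t\<in>T. x t) \<le> (\<Sum>t\<in>T. R * (\<Sum>i\<in>I. (a i t / S i) / m))"
      by (rule sum_mono[OF bound])
    also have "\<dots> = R * (\<Sum>i\<in>I. \<Sum>t\<in>T. (a i t / S i) / m)"
      by (subst sum.swap) (simp add: sum_distrib_left)
    also have "(\<Sum>i\<in>I. \<Sum>t\<in>T. (a i t / S i) / m) = (\<Sum>i\<in>I. (S i / S i) / m)"
      by (simp only: S_def sum_divide_distrib)
    also have "\<dots> = (\<Sum>i\<in>I. 1 / m)"
      by (intro sum.cong) (auto dest: Spos)
    also have "\<dots> = 1" using m by (simp add: m_def)
    finally have "(\<Sum>t\<in>T. x t) \<le> R" by simp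
    then have "(\<Sum>t\<in>T. x t) ^ m \<le> R ^ m"
      using x by (intro power_mono sum_nonneg) auto
    then show ?thesis unfolding Rm unfolding m_def S_def .
  qed
qed

text \<open>Induction on \<open>I\<close>, slicing \<open>F\<close> by the new coordinate
  \<open>j\<close>. A slice is no larger than the projection of \<open>F\<close> along
  \<open>j\<close>, and the induction hypothesis bounds it by its own projections; the product of
  both bounds is summed by the Hoelder inequality above. Projecting means overwriting with
  \<open>z\<close>, and agreement outside \<open>I\<close> lets the induction shrink
  \<open>I\<close> within one function type.\<close>

lemma Loomis_Whitney_card:
  fixes F :: "('i \<Rightarrow> 'a) set" and z :: 'a
  assumes "finite I" "finite F" "F \<noteq> {}"
    and "\<And>f g j. f \<in> F \<Longrightarrow> g \<in> F \<Longrightarrow> j \<notin> I \<Longrightarrow> f j = g j"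
  shows "card F ^ (card I - 1) \<le> (\<Prod>i\<in>I. card ((\<lambda>f. f(i := z)) ` F))"
  using assms
proof (induction I arbitrary: F rule: finite_induct)
  case empty
  then show ?case by simp
next
  case (insert j I)
  note [simp] = insert.prems(1)
  define \<pi> where "\<pi> i f = f(i := z)" for i :: 'i and f :: "'i \<Rightarrow> 'a"
  show ?case
  proof (cases "I = {}")
    \<comment> \<open>With a single coordinate the exponent is 0, so a nonempty projection
      suffices.\<close>
    case True
    have "card (\<pi> j ` F) > 0" using insert.prems by (simp add: card_gt_0_iff)
    then show ?thesis unfolding True \<pi>_def by (simp add: Suc_le_eq del: fun_upd_apply)
  next
    case False
    define T where "T = (\<lambda>f. f j) ` F"
    define G where "G t = {f \<in> F. f j = t}" for t
    have GF: "G t \<subseteq> F" for t by (auto simp: G_def)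
    have [simp]: "finite (G t)" for t using GF finite_subset insert.prems(1) by blast
    have [simp]: "finite T" by (simp add: T_def)
    have F: "F = (\<Union>t\<in>T. G t)" by (auto simp: T_def G_def)
    have cF: "card F = (\<Sum>t\<in>T. card (G t))"
      by (subst F, rule card_UN_disjoint) (auto simp: G_def)
    have slice: "card (G t) ^ card I \<le> card (\<pi> j ` F) * (\<Prod>i\<in>I. card (\<pi> i ` G t))" if t: "t \<in> T" for t
    proof -
      have "inj_on (\<pi> j) (G t)"
        by (rule inj_onI) (auto simp: \<pi>_def G_def fun_eq_iff split: if_splits, metis)
      then have "card (G t) = card (\<pi> j ` G t)" by (simp add: card_image)
      also have "\<dots> \<le> card (\<pi> j ` F)" using GF by (intro card_mono) auto
      finally have 1: "card (G t) \<le> card (\<pi> j ` F)" .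
      have 2: "card (G t) ^ (card I - 1) \<le> (\<Prod>i\<in>I. card (\<pi> i ` G t))"
        unfolding \<pi>_def
      proof (rule insert.IH)
        show "G t \<noteq> {}" using t by (auto simp: T_def G_def)
        fix f g i assume "f \<in> G t" "g \<in> G t" "i \<notin> I"
        then show "f i = g i" using insert.prems(3)[of f g i] by (cases "i = j") (auto simp: G_def)
      qed auto
      have "card (G t) ^ card I = card (G t) * card (G t) ^ (card I - 1)"
        using False insert.hyps(1) by (simp add: card_gt_0_iff power_eq_if)
      then show ?thesis using mult_mono[OF 1 2] by simp
    qed
    \<comment> \<open>Overwriting coordinate \<open>i\<close> keeps coordinate \<open>j\<close>, so
      projections of different slices remain disjoint and their sizes add.\<close>
    have proj: "card (\<pi> i ` F) = (\<Sum>t\<in>T. card (\<pi> i ` G t))" if "i \<in> I" for i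
    proof -
      have "i \<noteq> j" using that insert.hyps(2) by auto
      have "\<pi> i ` F = (\<Union>t\<in>T. \<pi> i ` G t)" by (subst F) auto
      also have "card \<dots> = (\<Sum>t\<in>T. card (\<pi> i ` G t))"
      proof (rule card_UN_disjoint; (intro ballI impI)?)
        fix t u :: 'a assume tu: "t \<noteq> u"
        have "f j = v" if "f \<in> \<pi> i ` G v" for f v
          using that \<open>i \<noteq> j\<close> by (auto simp: \<pi>_def G_def)
        then show "\<pi> i ` G t \<inter> \<pi> i ` G u = {}" using tu by (metis disjoint_iff)
      qed auto
      finally show ?thesis .
    qed
    have "(\<Sum>t\<in>T. real (card (G t))) ^ card I
            \<le> real (card (\<pi> j ` F)) * (\<Prod>i\<in>I. \<Sum>t\<in>T. real (card (\<pi> i ` G t)))"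
    proof (rule sum_power_le_prod_sum)
      fix t assume "t \<in> T"
      from slice[OF this] show "real (card (G t)) ^ card I
          \<le> real (card (\<pi> j ` F)) * (\<Prod>i\<in>I. real (card (\<pi> i ` G t)))"
        by (metis of_nat_le_iff of_nat_mult of_nat_power of_nat_prod)
    qed (use False insert.hyps in auto)
    then have "real (card F) ^ card I \<le> real (card (\<pi> j ` F)) * (\<Prod>i\<in>I. real (card (\<pi> i ` F)))"
      by (simp add: cF proj)
    then have "card F ^ card I \<le> card (\<pi> j ` F) * (\<Prod>i\<in>I. card (\<pi> i ` F))"
      by (metis of_nat_le_iff of_nat_mult of_nat_power of_nat_prod)
    then show ?thesis using insert.hyps unfolding \<pi>_def by (simp del: fun_upd_apply)
  qed
qed

section \<open>Isoperimetry in the grid\<close>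

definition grid :: "nat \<Rightarrow> ('n::finite \<Rightarrow> nat) set" where
  "grid N = {g. \<forall>i. g i < N}"

lemma grid_eq_PiE: "grid N = Pi\<^sub>E UNIV (\<lambda>_. {..<N})"
  by (auto simp: grid_def PiE_def)

lemma finite_grid [simp]: "finite (grid N :: ('n::finite \<Rightarrow> nat) set)"
  by (simp add: grid_eq_PiE finite_PiE)

lemma fun_upd_in_grid: "g \<in> grid N \<Longrightarrow> v < N \<Longrightarrow> g(i := v) \<in> grid N"
  by (simp add: grid_def)

text \<open>Loomis--Whitney gives a direction in which many lines meet \<open>F\<close>; since \<open>F\<close> is not too big,
  only a fixed proportion of these can be contained in \<open>F\<close>, and each of the others contains a boundary edge.\<close>

lemma grid_isoperimetric:
  fixes F :: "('n::finite \<Rightarrow> nat) set"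
  defines "n \<equiv> real CARD('n)"
  assumes F: "F \<subseteq> grid N" "F \<noteq> {}" and small: "real (card F) \<le> 3/4 * real N ^ CARD('n)"
  shows "\<exists>i. (1 - (3/4) powr (1 / n)) * real (card F) powr ((n - 1) / n)
      \<le> real (card {g \<in> grid N. g i + 1 < N \<and> (g \<in> F \<longleftrightarrow> g(i := g i + 1) \<notin> F)})"
proof -
  have finF: "finite F" using F(1) finite_grid finite_subset by blast
  have cF: "card F > 0" using F(2) finF by (simp add: card_gt_0_iff)
  have n1: "n \<ge> 1" unfolding n_def
    by (metis One_nat_def Suc_leI of_nat_1 of_nat_le_iff zero_less_card_finite)
  have N: "N > 0" using F by (cases N) (auto simp: grid_def)
  define \<pi> where "\<pi> i = (\<lambda>f::'n \<Rightarrow> nat. f(i := 0))" for i :: 'n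
  define p where "p = real (card F) powr ((n - 1) / n)"
  have "p > 0" using cF by (simp add: p_def)
  \<comment> \<open>If all projections were smaller than \<open>p\<close>, their product would be
    below \<open>p powr n\<close>, which is \<open>card F ^ (n - 1)\<close>, against
    Loomis--Whitney.\<close>
  have "\<exists>i. p \<le> real (card (\<pi> i ` F))"
  proof (rule ccontr)
    assume "\<not> ?thesis"
    then have lt: "real (card (\<pi> i ` F)) < p" for i by (simp add: not_le)
    have "real (card F) ^ (CARD('n) - 1) \<le> (\<Prod>i\<in>UNIV. real (card (\<pi> i ` F)))"
      using Loomis_Whitney_card[of UNIV F 0] finF F(2) unfolding \<pi>_def
      by (simp flip: of_nat_power of_nat_prod)
    also have "\<dots> < (\<Prod>i\<in>(UNIV::'n set). p)"
      using lt \<open>p > 0\<close> by (intro prod_mono_strict) (auto intro: less_imp_le)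
    also have "\<dots> = p powr n" using \<open>p > 0\<close> by (simp add: n_def powr_realpow)
    also have "\<dots> = real (card F) powr (n - 1)" using n1 by (simp add: p_def powr_powr)
    also have "n - 1 = real (CARD('n) - 1)" by (simp add: n_def of_nat_diff Suc_leI)
    also have "real (card F) powr \<dots> = real (card F) ^ (CARD('n) - 1)"
      using cF by (subst powr_realpow) auto
    finally show False by simp
  qed
  then obtain i where i: "p \<le> real (card (\<pi> i ` F))" by blast
  \<comment> \<open>The lines in direction \<open>i\<close> contained in \<open>F\<close>, each
    represented by its point with coordinate 0. They are disjoint with \<open>N\<close> points each,
    so there are at most \<open>card F / N\<close> of them.\<close>
  define full where "full = {q \<in> \<pi> i ` F. \<forall>v<N. q(i := v) \<in> F}"
  define bd where "bd = {g \<in> grid N. g i + 1 < N \<and> (g \<in> F \<longleftrightarrow> g(i := g i + 1) \<notin> F)}"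
  have finfull: "finite full" using finF by (simp add: full_def)
  have finbd: "finite bd" by (simp add: bd_def)
  have \<pi>upd: "\<pi> i (q(i := v)) = q" if "q \<in> \<pi> i ` F" for q v
    using that by (auto simp: \<pi>_def)
  have "card (full \<times> {..<N}) \<le> card F"
  proof (rule card_inj_on_le[OF _ _ finF])
    show "inj_on (\<lambda>(q, v). q(i := v)) (full \<times> {..<N})"
    proof (rule inj_onI, clarify)
      fix q v q' v' assume *: "q \<in> full" "q' \<in> full" "q(i := v) = q'(i := v')"
      then have "q = q'" using \<pi>upd[of q v] \<pi>upd[of q' v'] by (auto simp: full_def)
      moreover have "v = v'" using fun_cong[OF *(3), of i] by simp
      ultimately show "q = q' \<and> v = v'" by simp
    qed
  qed (auto simp: full_def)
  then have "real (card full) * real N \<le> real (card F)"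
    by (simp add: card_cartesian_product flip: of_nat_mult)
  then have "real (card full) \<le> real (card F) / real N" using N by (simp add: field_simps)
  \<comment> \<open>Since \<open>card F\<close> is \<open>p\<close> times its own
    \<open>n\<close>-th root, the density bound 3/4 becomes a bound on the proportion of full lines
    relative to \<open>p\<close>.\<close>
  also have "\<dots> = p * (real (card F) / real N ^ CARD('n)) powr (1 / n)"
  proof -
    have "real (card F) = p * real (card F) powr (1 / n)"
      using cF n1 by (simp add: p_def flip: powr_add add_divide_distrib)
    moreover have "(real N ^ CARD('n)) powr (1 / n) = real N"
      using N n1 by (simp add: n_def powr_powr flip: powr_realpow)
    ultimately show ?thesis using N by (simp add: powr_divide)
  qed
  also have "\<dots> \<le> p * (3/4) powr (1 / n)"
    using small N n1 \<open>p > 0\<close> by (intro mult_left_mono powr_mono2) (auto simp: field_simps)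
  finally have full: "real (card full) \<le> p * (3/4) powr (1 / n)" .
  \<comment> \<open>On a line that meets \<open>F\<close> without being contained in it, membership
    changes between two consecutive points; otherwise it would be constant along the line.\<close>
  have "\<exists>v. q(i := v) \<in> bd" if q: "q \<in> \<pi> i ` F - full" for q
  proof (rule ccontr)
    assume none: "\<not> ?thesis"
    obtain f where f: "f \<in> F" "q = \<pi> i f" using q by blast
    have fg: "f \<in> grid N" using f F by blast
    have step: "q(i := v) \<in> F \<longleftrightarrow> q(i := Suc v) \<in> F" if "Suc v < N" for v
    proof -
      have "q(i := v) \<in> grid N" using fg f that by (auto simp: \<pi>_def grid_def)
      then show ?thesis using none that by (auto simp: bd_def)
    qed
    have all: "q(i := v) \<in> F \<longleftrightarrow> q(i := 0) \<in> F" if "v < N" for v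
      using that by (induction v) (auto simp: step)
    have "q(i := f i) \<in> F" using f by (simp add: \<pi>_def)
    moreover have "f i < N" using fg by (simp add: grid_def)
    ultimately have "\<forall>v<N. q(i := v) \<in> F" using all by blast
    then have "q \<in> full" using q by (simp add: full_def)
    then show False using q by simp
  qed
  then have "\<forall>q\<in>\<pi> i ` F - full. \<exists>v. q(i := v) \<in> bd" by (intro ballI)
  from bchoice[OF this] obtain v where v: "\<forall>q\<in>\<pi> i ` F - full. q(i := v q) \<in> bd" ..
  have "card (\<pi> i ` F - full) \<le> card bd"
  proof (rule card_inj_on_le[OF _ _ finbd])
    show "inj_on (\<lambda>q. q(i := v q)) (\<pi> i ` F - full)"
    proof (rule inj_onI)
      fix q q' assume *: "q \<in> \<pi> i ` F - full" "q' \<in> \<pi> i ` F - full" "q(i := v q) = q'(i := v q')"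
      have "q = \<pi> i (q(i := v q))" using *(1) by (simp only: \<pi>upd Diff_iff)
      also have "\<dots> = q'" unfolding *(3) using *(2) by (simp only: \<pi>upd Diff_iff)
      finally show "q = q'" .
    qed
  qed (use v in auto)
  moreover have "card (\<pi> i ` F - full) = card (\<pi> i ` F) - card full"
    by (rule card_Diff_subset[OF finfull]) (auto simp: full_def)
  ultimately have "real (card (\<pi> i ` F)) - real (card full) \<le> real (card bd)" by linarith
  then have "(1 - (3/4) powr (1 / n)) * p \<le> real (card bd)"
    using i full by (simp add: algebra_simps)
  then show ?thesis unfolding p_def bd_def by blast
qed

text \<open>Not a metric: \<open>disagree p p\<close> is \<open>2 * p * (1 - p)\<close>, which
  vanishes only at 0 and 1. This is why sums over equal cells detect mixed cells.\<close>

definition disagree :: "real \<Rightarrow> real \<Rightarrow> real" where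
  "disagree p q = p * (1 - q) + q * (1 - p)"

lemma disagree_commute: "disagree p q = disagree q p"
  by (simp add: disagree_def)

lemma disagree_nonneg: "0 \<le> p \<Longrightarrow> p \<le> 1 \<Longrightarrow> 0 \<le> q \<Longrightarrow> q \<le> 1 \<Longrightarrow> 0 \<le> disagree p q"
  by (simp add: disagree_def)

text \<open>For independent events with probabilities \<open>p\<close>, \<open>q\<close>,
  \<open>w\<close>, the gap is twice the probability that the first two agree and the third differs
  from both.\<close>

lemma disagree_triangle:
  assumes "0 \<le> p" "p \<le> 1" "0 \<le> q" "q \<le> 1" "0 \<le> w" "w \<le> 1"
  shows "disagree p q \<le> disagree p w + disagree w q"
proof -
  have "disagree p w + disagree w q - disagree p q = 2 * (w * ((1 - p) * (1 - q)) + (1 - w) * (p * q))"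
    by (simp add: disagree_def algebra_simps)
  also have "\<dots> \<ge> 0" using assms by (intro mult_nonneg_nonneg add_nonneg_nonneg) auto
  finally show ?thesis by simp
qed

text \<open>Apart from the constant 1/2, the value is a product of the two deviations from 1/2. This
  handles adjacent cells on opposite sides of the density threshold.\<close>

lemma disagree_ge_half:
  assumes "1/2 \<le> p" "p \<le> 1" "0 \<le> q" "q \<le> 1/2"
  shows "1/2 \<le> disagree p q"
proof -
  have "disagree p q = 1/2 + 2 * ((p - 1/2) * (1/2 - q))"
    by (simp add: disagree_def algebra_simps)
  then show ?thesis using assms by simp
qed

text \<open>The cases are: half of the mass lies outside \<open>F\<close>; \<open>F\<close> exceeds
  3/4 of the grid; neither. Since 3/4 lies strictly between 1/2 and 1, the second case leaves a
  defect of a quarter of the grid and the third a positive isoperimetric constant.\<close>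

lemma grid_density_isoperimetric:
  fixes d :: "('n::finite \<Rightarrow> nat) \<Rightarrow> real" and N :: nat
  defines "n \<equiv> real CARD('n)"
  defines "D \<equiv> (\<Sum>g\<in>grid N. d g)"
  assumes d: "\<And>g. g \<in> grid N \<Longrightarrow> 0 \<le> d g \<and> d g \<le> 1"
    and half: "D \<le> real N ^ CARD('n) / 2"
    and X0: "(\<Sum>g\<in>grid N. disagree (d g) (d g)) \<le> X"
    and X1: "\<And>i. (\<Sum>g\<in>{g\<in>grid N. g i + 1 < N}. disagree (d g) (d (g(i := g i + 1)))) \<le> X"
  shows "D / 2 \<le> X \<or> real N ^ CARD('n) / 4 \<le> X
      \<or> (1 - (3/4) powr (1 / n)) / 2 * (D / 2) powr ((n - 1) / n) \<le> X"
proof -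
  have n1: "n \<ge> 1" unfolding n_def
    by (metis One_nat_def Suc_leI of_nat_1 of_nat_le_iff zero_less_card_finite)
  define F where "F = {g \<in> grid N. d g \<ge> 1/2}"
  have FG: "F \<subseteq> grid N" by (auto simp: F_def)
  have finF: "finite F" using FG finite_grid finite_subset by blast
  have split: "sum f (grid N) = sum f F + sum f (grid N - F)" for f :: "_ \<Rightarrow> real"
    using sum.subset_diff[OF FG finite_grid, of f] by simp
  have nonneg: "0 \<le> disagree (d g) (d g)" if "g \<in> grid N" for g
    using d[OF that] by (simp add: disagree_nonneg)
  have subX: "sum (\<lambda>g. disagree (d g) (d g)) A \<le> X" if "A \<subseteq> grid N" for A
    using sum_mono2[OF finite_grid that, of "\<lambda>g. disagree (d g) (d g)"] nonneg X0 by force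
  \<comment> \<open>The diagonal term \<open>2 * d * (1 - d)\<close> dominates the smaller of
    \<open>d\<close> and \<open>1 - d\<close>; \<open>big\<close> and \<open>big'\<close> treat the
    two sides of the threshold.\<close>
  have big: "d g \<le> disagree (d g) (d g)" if "g \<in> grid N - F" for g
  proof -
    have "disagree (d g) (d g) - d g = d g * (1 - 2 * d g)" by (simp add: disagree_def algebra_simps)
    also have "\<dots> \<ge> 0" using that d[of g] by (intro mult_nonneg_nonneg) (auto simp: F_def)
    finally show ?thesis by simp
  qed
  have big': "1 - d g \<le> disagree (d g) (d g)" if "g \<in> F" for g
  proof -
    have "disagree (d g) (d g) - (1 - d g) = (1 - d g) * (2 * d g - 1)" by (simp add: disagree_def algebra_simps)
    also have "\<dots> \<ge> 0" using that d[of g] by (intro mult_nonneg_nonneg) (auto simp: F_def)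
    finally show ?thesis by simp
  qed
  have sumF: "sum d F \<le> real (card F)"
    using sum_bounded_above[of F d 1] d FG by auto
  consider "D / 2 \<le> sum d (grid N - F)" | "3/4 * real N ^ CARD('n) < real (card F)"
    | "sum d (grid N - F) < D / 2" "real (card F) \<le> 3/4 * real N ^ CARD('n)" by linarith
  then show ?thesis
  proof cases
    case 1
    also have "sum d (grid N - F) \<le> sum (\<lambda>g. disagree (d g) (d g)) (grid N - F)"
      by (rule sum_mono[OF big])
    also have "\<dots> \<le> X" by (rule subX) auto
    finally show ?thesis by simp
  next
    case 2
    have "sum d F \<le> D" using split[of d] sum_nonneg[of "grid N - F" d] d by (auto simp: D_def)
    then have "real N ^ CARD('n) / 4 \<le> (\<Sum>g\<in>F. 1 - d g)"
      using half 2 by (simp add: sum_subtractf)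
    also have "\<dots> \<le> sum (\<lambda>g. disagree (d g) (d g)) F" by (rule sum_mono[OF big'])
    also have "\<dots> \<le> X" by (rule subX[OF FG])
    finally show ?thesis by simp
  next
    case 3
    have DF: "D / 2 \<le> real (card F)" using split[of d] sumF 3(1) by (simp add: D_def)
    have D0: "0 \<le> D" unfolding D_def using d by (simp add: sum_nonneg)
    show ?thesis
    proof (cases "F = {}")
      \<comment> \<open>This case is contradictory: all mass would lie outside \<open>F\<close>,
        giving \<open>D < D / 2\<close> with \<open>0 \<le> D\<close>.\<close>
      case True
      then show ?thesis using 3(1) D0 by (simp flip: D_def)
    next
      case False
      define c where "c = 1 - (3/4::real) powr (1 / n)"
      have c: "c \<ge> 0" using n1 by (simp add: c_def powr_le1)
      from grid_isoperimetric[OF FG False 3(2)] obtain i where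
        i: "c * real (card F) powr ((n - 1) / n)
          \<le> real (card {g \<in> grid N. g i + 1 < N \<and> (g \<in> F \<longleftrightarrow> g(i := g i + 1) \<notin> F)})"
        (is "_ \<le> real (card ?B)") unfolding n_def c_def by blast
      have "c / 2 * (D / 2) powr ((n - 1) / n) \<le> c / 2 * real (card F) powr ((n - 1) / n)"
        using c DF D0 n1 by (intro mult_left_mono powr_mono2) auto
      also have "\<dots> \<le> (\<Sum>g\<in>?B. 1/2)" using i by simp
      also have "\<dots> \<le> (\<Sum>g\<in>?B. disagree (d g) (d (g(i := g i + 1))))"
      proof (rule sum_mono)
        fix g assume g: "g \<in> ?B"
        have g': "g(i := g i + 1) \<in> grid N" using g by (auto intro: fun_upd_in_grid)
        show "1/2 \<le> disagree (d g) (d (g(i := g i + 1)))"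
        proof (cases "g \<in> F")
          case True
          then have "g(i := g i + 1) \<notin> F" using g by blast
          then show ?thesis using True d[OF g'] d[of g] g g' by (intro disagree_ge_half) (auto simp: F_def)
        next
          case False
          then have "g(i := g i + 1) \<in> F" using g by blast
          then show ?thesis using False d[OF g'] d[of g] g g'
            by (subst disagree_commute, intro disagree_ge_half) (auto simp: F_def)
        qed
      qed
      also have "\<dots> \<le> (\<Sum>g\<in>{g\<in>grid N. g i + 1 < N}. disagree (d g) (d (g(i := g i + 1))))"
      proof (rule sum_mono2)
        fix g assume "g \<in> {g \<in> grid N. g i + 1 < N} - ?B"
        then show "0 \<le> disagree (d g) (d (g(i := g i + 1)))"
          using d[of g] d[of "g(i := g i + 1)"] by (intro disagree_nonneg) (auto intro: fun_upd_in_grid)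
      qed auto
      also have "\<dots> \<le> X" by (rule X1)
      finally show ?thesis by (simp add: c_def)
    qed
  qed
qed

section \<open>Cells and annuli\<close>

lemma box_subset_half_open:
  fixes u v :: "real ^ 'n"
  shows "box u v \<subseteq> {x. \<forall>i. u $ i \<le> x $ i \<and> x $ i < v $ i}"
    and "{x. \<forall>i. u $ i \<le> x $ i \<and> x $ i < v $ i} \<subseteq> cbox u v"
  by (auto simp: mem_box_cart) (meson less_imp_le)+

lemma negligible_cbox_diff_half_open:
  fixes u v :: "real ^ 'n"
  shows "negligible (cbox u v - {x. \<forall>i. u $ i \<le> x $ i \<and> x $ i < v $ i})"
  by (rule negligible_subset[OF negligible_frontier_interval[of u v]] Diff_mono order_refl box_subset_half_open(1))+

lemma half_open_lmeasurable:
  fixes u v :: "real ^ 'n"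
  shows "{x. \<forall>i. u $ i \<le> x $ i \<and> x $ i < v $ i} \<in> lmeasurable" (is "?H \<in> _")
proof -
  have "?H = cbox u v - (cbox u v - ?H)" using box_subset_half_open(2)[of u v] by blast
  also have "\<dots> \<in> lmeasurable"
    by (intro fmeasurable.Diff lmeasurable_cbox negligible_imp_measurable negligible_cbox_diff_half_open)
  finally show ?thesis .
qed

lemma measure_cube:
  fixes a :: "real ^ 'n"
  assumes "l \<ge> 0"
  shows "measure lebesgue (cube a l) = l ^ CARD('n)"
proof -
  have "cbox a (\<chi> i. a $ i + l) \<noteq> {}" using assms by (simp add: interval_ne_empty_cart)
  then show ?thesis by (simp add: cube_def content_cbox_cart)
qed

text \<open>Half-open, so that for \<open>h > 0\<close> different cells are disjoint and the index
  of a point is found by rounding down. The closed cube differs from the union of its cells only by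
  a null set.\<close>

definition cell :: "real ^ 'n \<Rightarrow> real \<Rightarrow> ('n \<Rightarrow> nat) \<Rightarrow> (real ^ 'n) set" where
  "cell a h g = {x. \<forall>i. a $ i + h * g i \<le> x $ i \<and> x $ i < a $ i + h * g i + h}"

lemma cell_eq_half_open:
  "cell a h g = {x. \<forall>i. (\<chi> i. a $ i + h * g i) $ i \<le> x $ i \<and> x $ i < (\<chi> i. (\<chi> i. a $ i + h * g i) $ i + h) $ i}"
  by (simp add: cell_def)

lemma lmeasurable_cell [simp, intro]: "cell a h g \<in> lmeasurable"
  unfolding cell_eq_half_open by (rule half_open_lmeasurable)

lemma sets_cell [simp, measurable]: "cell a h g \<in> sets lebesgue"
  using lmeasurable_cell fmeasurableD by blast

lemma measure_cell:
  fixes a :: "real ^ 'n"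
  assumes "h \<ge> 0"
  shows "measure lebesgue (cell a h g) = h ^ CARD('n)"
proof -
  define b :: "real ^ 'n" where "b = (\<chi> i. a $ i + h * g i)"
  have c: "cell a h g = {x. \<forall>i. b $ i \<le> x $ i \<and> x $ i < (\<chi> i. b $ i + h) $ i}"
    by (simp add: cell_def b_def)
  have "measure lebesgue (cell a h g) = measure lebesgue (cube b h)"
    unfolding c cube_def
  proof (rule measure_negligible_symdiff[OF lmeasurable_cbox])
    show "negligible (cbox b (\<chi> i. b $ i + h) - {x. \<forall>i. b $ i \<le> x $ i \<and> x $ i < (\<chi> i. b $ i + h) $ i}
      \<union> ({x. \<forall>i. b $ i \<le> x $ i \<and> x $ i < (\<chi> i. b $ i + h) $ i} - cbox b (\<chi> i. b $ i + h)))"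
      unfolding Diff_eq_empty_iff[THEN iffD2, OF box_subset_half_open(2)] Un_empty_right
      by (rule negligible_cbox_diff_half_open)
  qed
  then show ?thesis using measure_cube[OF assms] by simp
qed

lemma mem_cell_iff_floor:
  fixes x a :: "real ^ 'n"
  assumes "h > 0"
  shows "x \<in> cell a h g \<longleftrightarrow> (\<forall>i. \<lfloor>(x $ i - a $ i) / h\<rfloor> = int (g i))"
proof -
  have "(a $ i + h * g i \<le> x $ i \<and> x $ i < a $ i + h * g i + h) \<longleftrightarrow> \<lfloor>(x $ i - a $ i) / h\<rfloor> = int (g i)" for i
    using assms by (auto simp: floor_eq_iff field_simps)
  then show ?thesis by (simp add: cell_def)
qed

lemma cell_unique: "h > 0 \<Longrightarrow> x \<in> cell a h g \<Longrightarrow> x \<in> cell a h g' \<Longrightarrow> g = g'"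
  by (auto simp: mem_cell_iff_floor)

text \<open>The half-open cube of side \<open>h * N\<close> is itself written as a cell with index
  0. For \<open>N = 0\<close> both sides are empty.\<close>

lemma Union_cells:
  fixes a :: "real ^ 'n"
  assumes "h > 0"
  shows "(\<Union>g\<in>grid N. cell a h g) = cell a (h * N) (\<lambda>_. 0)"
proof (cases "N = 0")
  case True
  then show ?thesis by (auto simp: grid_def cell_def intro: not_less_iff_gr_or_eq[THEN iffD2])
next
  case False
  show ?thesis
  proof (intro set_eqI iffI)
    fix x assume "x \<in> (\<Union>g\<in>grid N. cell a h g)"
    then obtain g where g: "\<And>i. g i < N" "x \<in> cell a h g" by (auto simp: grid_def)
    have "h * g i + h \<le> h * N" for i
    proof -
      have "real (g i) + 1 \<le> real N" using g(1)[of i] by linarith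
      then show ?thesis using mult_left_mono[of "real (g i) + 1" "real N" h] assms by (simp add: algebra_simps)
    qed
    moreover have "0 \<le> h * g i" for i using assms by simp
    ultimately show "x \<in> cell a (h * N) (\<lambda>_. 0)"
      using g(2) by (simp add: cell_def) (smt (verit, best))
  next
    fix x assume x: "x \<in> cell a (h * N) (\<lambda>_. 0)"
    define g where "g i = nat \<lfloor>(x $ i - a $ i) / h\<rfloor>" for i
    have pos: "0 \<le> (x $ i - a $ i) / h" and lt: "(x $ i - a $ i) / h < N" for i
      using x assms by (auto simp: cell_def field_simps)
    have "g i < N" for i
      using pos[of i] lt[of i] by (simp add: g_def floor_less_iff nat_less_iff)
    moreover have "x \<in> cell a h g"
      using assms pos by (simp add: mem_cell_iff_floor g_def)
    ultimately show "x \<in> (\<Union>g\<in>grid N. cell a h g)" by (auto simp: grid_def)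
  qed
qed

lemma cell_zero_subset_cube: "cell a l (\<lambda>_. 0) \<subseteq> cube a l"
  by (auto simp: cell_def cube_def mem_box_cart) (meson less_imp_le)

lemma cell_subset_cube:
  assumes "h > 0" "g \<in> grid N"
  shows "cell a h g \<subseteq> cube a (h * N)"
proof -
  have "cell a h g \<subseteq> cell a (h * N) (\<lambda>_. 0)" using Union_cells[OF assms(1), where N=N and a=a] assms(2) by blast
  also have "\<dots> \<subseteq> cube a (h * N)" by (rule cell_zero_subset_cube)
  finally show ?thesis .
qed

lemma measure_cube_Int_eq_sum_cells:
  fixes a :: "real ^ 'n"
  assumes "h > 0" and E: "E \<in> sets lebesgue"
  shows "measure lebesgue (cube a (h * N) \<inter> E) = (\<Sum>g\<in>grid N. measure lebesgue (cell a h g \<inter> E))"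
proof -
  let ?C = "cell a (h * N) (\<lambda>_. 0)"
  have CQ: "?C \<subseteq> cube a (h * N)" by (rule cell_zero_subset_cube)
  have "negligible (cube a (h * N) - ?C)"
    using negligible_cbox_diff_half_open[of a "\<chi> i. a $ i + h * N"] by (simp add: cube_def cell_def)
  then have neg: "negligible ((?C \<inter> E) - (cube a (h * N) \<inter> E) \<union> ((cube a (h * N) \<inter> E) - (?C \<inter> E)))"
    by (rule negligible_subset) (use CQ in blast)
  have "measure lebesgue (cube a (h * N) \<inter> E) = measure lebesgue (?C \<inter> E)"
    by (rule measure_negligible_symdiff[OF _ neg]) (simp add: fmeasurable_Int_fmeasurable E)
  also have "?C \<inter> E = (\<Union>g\<in>grid N. cell a h g \<inter> E)"
    by (simp flip: Union_cells[OF assms(1)])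
  also have "measure lebesgue \<dots> = (\<Sum>g\<in>grid N. measure lebesgue (cell a h g \<inter> E))"
  proof (rule measure_finite_Union)
    show "disjoint_family_on (\<lambda>g. cell a h g \<inter> E) (grid N)"
      unfolding disjoint_family_on_def using cell_unique[OF assms(1)] by blast
    fix g :: "'n \<Rightarrow> nat"
    have "cell a h g \<inter> E \<in> lmeasurable" by (simp add: fmeasurable_Int_fmeasurable E)
    then show "emeasure lebesgue (cell a h g \<inter> E) \<noteq> \<infinity>" using fmeasurableD2 by (metis infinity_ennreal_def)
  qed (use E in auto)
  finally show ?thesis .
qed

text \<open>In coordinate \<open>i\<close> the index gap determines the distance up to
  \<open>h\<close>, and every other coordinate differs by at most \<open>h\<close>. One coordinate
  gives the lower bound, the sum of all coordinates the upper one.\<close>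

lemma cell_dist_bounds:
  fixes x y a :: "real ^ 'n"
  assumes "h > 0" and x: "x \<in> cell a h g" and y: "y \<in> cell a h (g(i := v))"
  shows "h * (\<bar>real (g i) - real v\<bar> - 1) \<le> dist x y"
    and "dist x y < h * (\<bar>real (g i) - real v\<bar> + real CARD('n))"
proof -
  have xj: "a $ j + h * g j \<le> x $ j" "x $ j < a $ j + h * g j + h" for j
    using x by (auto simp: cell_def)
  have yj: "a $ j + h * (g(i := v)) j \<le> y $ j" "y $ j < a $ j + h * (g(i := v)) j + h" for j
    using y unfolding cell_def by blast+
  have yi: "a $ i + h * v \<le> y $ i" "y $ i < a $ i + h * v + h" using yj[of i] by auto
  have e: "h * \<bar>real (g i) - real v\<bar> = \<bar>h * g i - h * v\<bar>"
    using \<open>h > 0\<close> by (simp add: abs_mult flip: right_diff_distrib)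
  have i: "h * \<bar>real (g i) - real v\<bar> - h \<le> \<bar>x $ i - y $ i\<bar>"
    "\<bar>x $ i - y $ i\<bar> < h * \<bar>real (g i) - real v\<bar> + h"
    unfolding e using xj[of i] yi by linarith+
  have j: "\<bar>x $ j - y $ j\<bar> \<le> h" if "j \<noteq> i" for j
    using xj[of j] yj[of j] that by auto
  have "\<bar>x $ i - y $ i\<bar> \<le> dist x y"
    using component_le_norm_cart[of "x - y" i] by (simp add: dist_norm)
  with i show "h * (\<bar>real (g i) - real v\<bar> - 1) \<le> dist x y" by (simp add: algebra_simps)
  have "dist x y \<le> (\<Sum>j\<in>UNIV. \<bar>x $ j - y $ j\<bar>)"
    using norm_le_l1_cart[of "x - y"] by (simp add: dist_norm)
  also have "\<dots> = \<bar>x $ i - y $ i\<bar> + (\<Sum>j\<in>UNIV - {i}. \<bar>x $ j - y $ j\<bar>)"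
    by (simp add: sum.remove[of UNIV i])
  also have "(\<Sum>j\<in>UNIV - {i}. \<bar>x $ j - y $ j\<bar>) \<le> real (card (UNIV - {i})) * h"
    using j by (intro sum_bounded_above) auto
  also have "real (card (UNIV - {i})) = real CARD('n) - 1"
    by (simp add: card_Diff_singleton of_nat_diff Suc_leI)
  finally show "dist x y < h * (\<bar>real (g i) - real v\<bar> + real CARD('n))"
    using i(2) by (simp add: algebra_simps)
qed

section \<open>Dyadic annuli and the annulus integral\<close>

lemma mem_cube_annulus:
  "y \<in> cube_annulus a l k x \<longleftrightarrow> y \<in> cube a l \<and> l / 2 ^ k / 2 \<le> dist x y \<and> dist x y < l / 2 ^ k"
proof -
  have "2 powr (- real k) * l = l / 2 ^ k" by (simp add: powr_minus powr_realpow field_simps)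
  moreover have "2 powr (- real k - 1) * l = l / 2 ^ k / 2"
    by (simp add: powr_diff powr_minus powr_realpow field_simps)
  ultimately show ?thesis by (auto simp: cube_annulus_def)
qed

lemma lmeasurable_cube_annulus [simp, intro]: "cube_annulus a l k x \<in> lmeasurable"
  unfolding cube_annulus_def cube_def by (intro fmeasurable.Diff fmeasurable_Int_fmeasurable) auto

lemma sets_cube_annulus [simp]: "cube_annulus a l k x \<in> sets lebesgue"
  using lmeasurable_cube_annulus fmeasurableD by blast

text \<open>The outer ball lies in a cube of twice its radius. The bound is uniform in
  \<open>x\<close>, and its loss is a factor depending on the dimension.\<close>

lemma measure_cube_annulus_le:
  fixes a x :: "real ^ 'n"
  assumes "l > 0"
  shows "measure lebesgue (cube_annulus a l k x) \<le> (2 * (l / 2 ^ k)) ^ CARD('n)"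
proof -
  define r where "r = l / 2 ^ k"
  have "r > 0" using assms by (simp add: r_def)
  have "cube_annulus a l k x \<subseteq> cube (\<chi> i. x $ i - r) (2 * r)"
  proof
    fix y assume "y \<in> cube_annulus a l k x"
    then have d: "dist x y < r" by (simp add: mem_cube_annulus r_def)
    have "\<bar>x $ i - y $ i\<bar> < r" for i
      using component_le_norm_cart[of "x - y" i] d by (simp add: dist_norm)
    then have "x $ i - r \<le> y $ i \<and> y $ i \<le> r + x $ i" for i by (smt (verit))
    then show "y \<in> cube (\<chi> i. x $ i - r) (2 * r)" by (auto simp: cube_def mem_box_cart)
  qed
  then have "measure lebesgue (cube_annulus a l k x) \<le> measure lebesgue (cube (\<chi> i. x $ i - r) (2 * r))"
    by (intro measure_mono_fmeasurable) (auto simp: cube_def)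
  then show ?thesis using \<open>r > 0\<close> by (simp add: measure_cube r_def)
qed

lemma annulus_integral_abs_diff_indicator:
  assumes E: "E \<in> sets lebesgue"
  shows "(LINT y:cube_annulus a l k x|lebesgue. \<bar>indicat_real E x - indicat_real E y\<bar>)
    = (if x \<in> E then measure lebesgue (cube_annulus a l k x - E)
       else measure lebesgue (cube_annulus a l k x \<inter> E))"
proof -
  let ?A = "cube_annulus a l k x"
  have "(LINT y:?A|lebesgue. \<bar>indicat_real E x - indicat_real E y\<bar>)
      = integral\<^sup>L lebesgue (indicat_real (if x \<in> E then ?A - E else ?A \<inter> E))"
    unfolding set_lebesgue_integral_def by (rule Bochner_Integration.integral_cong) (auto simp: indicator_def)
  then show ?thesis by (simp add: space_borel split: if_splits)
qed

text \<open>Up to a null set \<open>E\<close> is a Borel set \<open>B\<close>. The pairs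
  \<open>(x, y)\<close> with \<open>y\<close> in \<open>B\<close> and in the annulus around
  \<open>x\<close> form a measurable set in the product, so the measure of its sections is
  measurable in \<open>x\<close>.\<close>

lemma measurable_measure_annulus_Int:
  fixes E :: "(real ^ 'n) set"
  assumes E: "E \<in> sets lebesgue"
  shows "(\<lambda>x. measure lebesgue (cube_annulus a l k x \<inter> E)) \<in> borel_measurable lebesgue"
proof -
  from E obtain B Z Z' where B: "E = B \<union> Z" "Z \<subseteq> Z'" "Z' \<in> null_sets lborel" "B \<in> sets lborel"
    by (rule sets_completionE)
  have Z: "Z \<in> null_sets lebesgue"
    by (rule null_sets_completion_subset[OF B(2) null_sets_completionI[OF B(3)]])
  have [measurable]: "B \<in> sets borel" "cube a l \<in> sets borel" using B(4) by (auto simp: cube_def)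
  have eq: "measure lebesgue (cube_annulus a l k x \<inter> E) = measure lborel (cube_annulus a l k x \<inter> B)" for x
  proof -
    have b: "cube_annulus a l k x \<inter> B \<in> sets borel" by (simp add: cube_annulus_def cube_def)
    have "cube_annulus a l k x \<inter> E = (cube_annulus a l k x \<inter> B) \<union> (cube_annulus a l k x \<inter> Z)"
      using B(1) by blast
    moreover have "cube_annulus a l k x \<inter> Z \<in> null_sets lebesgue"
      using Z by (simp add: null_set_Int1)
    ultimately show ?thesis using b by (simp add: measure_Un_null_set)
  qed
  have "(\<lambda>x. emeasure lborel (cube_annulus a l k x \<inter> B)) \<in> borel_measurable borel"
  proof (rule lborel.measurable_emeasure)
    have "{z \<in> space (borel \<Otimes>\<^sub>M lborel). snd z \<in> cube a l \<and> snd z \<in> B \<and>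
        l / 2 ^ k / 2 \<le> dist (fst z) (snd z) \<and> dist (fst z) (snd z) < l / 2 ^ k}
      \<in> sets (borel \<Otimes>\<^sub>M (lborel :: (real ^ 'n) measure))"
      by measurable
    then show "{z \<in> space (borel \<Otimes>\<^sub>M lborel). snd z \<in> cube_annulus a l k (fst z) \<inter> B} \<in> sets (borel \<Otimes>\<^sub>M lborel)"
      by (simp add: mem_cube_annulus conj_ac)
  qed auto
  then have "(\<lambda>x. measure lborel (cube_annulus a l k x \<inter> B)) \<in> borel_measurable borel"
    unfolding measure_def by measurable
  then show ?thesis unfolding eq by (intro measurable_completion) (simp only: measurable_lborel2)
qed

text \<open>For \<open>x\<close> in the cell \<open>g\<close> the annulus contains the whole cell
  \<open>\<phi> g\<close>, so the inner integral is at least the measure of the part of that cell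
  separated from \<open>x\<close> by \<open>E\<close>. Bounding the annulus volume and integrating
  over the cell \<open>g\<close> yields \<open>disagree\<close> times the squared cell
  volume.\<close>

lemma annulus_average_ge_sum_disagree:
  fixes a :: "real ^ 'n" and \<phi> :: "('n \<Rightarrow> nat) \<Rightarrow> ('n \<Rightarrow> nat)"
  defines "d \<equiv> \<lambda>h E g. measure lebesgue (cell a h g \<inter> E) / h ^ CARD('n)"
  assumes h: "h > 0" and N: "N > 0" and l: "l = h * real N" and E: "E \<in> sets lebesgue"
    and G0: "G0 \<subseteq> grid N" "\<And>g. g \<in> G0 \<Longrightarrow> \<phi> g \<in> grid N"
    and sep: "\<And>g x y. g \<in> G0 \<Longrightarrow> x \<in> cell a h g \<Longrightarrow> y \<in> cell a h (\<phi> g)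
      \<Longrightarrow> l / 2 ^ k / 2 \<le> dist x y \<and> dist x y < l / 2 ^ k"
  shows "(h ^ CARD('n))\<^sup>2 / (2 * (l / 2 ^ k)) ^ CARD('n) * (\<Sum>g\<in>G0. disagree (d h E g) (d h E (\<phi> g)))
    \<le> (LINT x:cube a l|lebesgue. 1 / measure lebesgue (cube_annulus a l k x) *
         (LINT y:cube_annulus a l k x|lebesgue. \<bar>indicat_real E x - indicat_real E y\<bar>))"
proof -
  define H where "H = h ^ CARD('n)"
  define V where "V = (2 * (l / 2 ^ k)) ^ CARD('n)"
  have l0: "l > 0" using h N by (simp add: l)
  have H0: "H > 0" using h by (simp add: H_def)
  have V0: "V > 0" using l0 by (simp add: V_def)
  define A where "A = cube_annulus a l k"
  have A: "A x \<in> lmeasurable" for x by (simp add: A_def)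
  define J where "J x = (if x \<in> E then measure lebesgue (A x - E) else measure lebesgue (A x \<inter> E))" for x
  define K where "K x = 1 / measure lebesgue (A x) * J x" for x
  have J: "0 \<le> J x" "J x \<le> measure lebesgue (A x)" for x
    using A[of x] fmeasurableD[OF A[of x]] E
    by (auto simp: J_def intro!: measure_mono_fmeasurable sets.Diff sets.Int)
  have K01: "0 \<le> K x" "K x \<le> 1" for x
    using J[of x] by (auto simp: K_def divide_le_eq)
  have KJ: "J x / V \<le> K x" for x
  proof (cases "measure lebesgue (A x) = 0")
    \<comment> \<open>Division by zero makes \<open>K x\<close> zero, and \<open>J x\<close>, being
      at most the measure of the annulus, is zero as well.\<close>
    case True
    then show ?thesis using J[of x] by (simp add: K_def)
  next
    case False
    then have "measure lebesgue (A x) > 0" by (simp add: zero_less_measure_iff)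
    then show ?thesis
      using measure_cube_annulus_le[OF l0, of a k x] J(1)[of x]
      by (simp add: K_def A_def V_def frac_le)
  qed
  have J_meas: "J \<in> borel_measurable lebesgue"
  proof -
    have "J = (\<lambda>x. if x \<in> E then measure lebesgue (A x \<inter> (- E)) else measure lebesgue (A x \<inter> E))"
      by (simp add: J_def Diff_eq fun_eq_iff)
    also have "\<dots> \<in> borel_measurable lebesgue"
      using E unfolding A_def
      by (intro measurable_If_set measurable_measure_annulus_Int) (auto simp: Compl_in_sets_lebesgue)
    finally show ?thesis .
  qed
  have K_meas: "K \<in> borel_measurable lebesgue"
    using measurable_measure_annulus_Int[of UNIV a l k] J_meas unfolding K_def A_def[symmetric] by simp
  have Q: "cube a l \<in> lmeasurable" by (simp add: cube_def)
  \<comment> \<open>A non-integrable function would have integral 0 by default, so comparison from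
    below requires integrability; \<open>K\<close> is bounded by 1 on a set of finite
    measure.\<close>
  have K_int: "integrable lebesgue (\<lambda>x. indicator (cube a l) x *\<^sub>R K x)"
    using Q K_meas K01 fmeasurableD[OF Q] fmeasurableD2[OF Q]
    by (intro integrableI_bounded_set_indicator[where B=1]) (auto simp: less_top)
  have cE: "cell a h g \<inter> E \<in> lmeasurable" "cell a h g - E \<in> lmeasurable" for g
    using E by (auto intro: fmeasurable_Int_fmeasurable fmeasurable_Diff)
  have mE: "measure lebesgue (cell a h g \<inter> E) = H * d h E g" for g
    using h by (simp add: d_def H_def)
  have mD: "measure lebesgue (cell a h g - E) = H * (1 - d h E g)" for g
  proof -
    have eq: "cell a h g - E = cell a h g - cell a h g \<inter> E" by blast
    have "measure lebesgue (cell a h g - cell a h g \<inter> E) = measure lebesgue (cell a h g) - measure lebesgue (cell a h g \<inter> E)"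
      using E fmeasurableD2[OF lmeasurable_cell[of a h g]]
      by (intro measure_Diff) (simp_all del: emeasure_completion)
    then show ?thesis
      unfolding eq using measure_cell[of h a g] h mE[of g] by (simp add: H_def right_diff_distrib)
  qed
  \<comment> \<open>A simple function below the integrand. Since the cells are disjoint, at most one
    index \<open>g\<close> contributes at any point.\<close>
  define L where "L x = (\<Sum>g\<in>G0. H * (1 - d h E (\<phi> g)) / V * indicat_real (cell a h g \<inter> E) x
      + H * d h E (\<phi> g) / V * indicat_real (cell a h g - E) x)" for x
  have hb: "has_bochner_integral lebesgue L (\<Sum>g\<in>G0. H * (1 - d h E (\<phi> g)) / V * (H * d h E g)
      + H * d h E (\<phi> g) / V * (H * (1 - d h E g)))"
    unfolding L_def mE[symmetric] mD[symmetric]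
    using cE by (intro has_bochner_integral_sum has_bochner_integral_add has_bochner_integral_mult_right
        has_bochner_integral_real_indicator) (auto simp: fmeasurable_def simp del: emeasure_completion)
  have LK: "L x \<le> indicator (cube a l) x *\<^sub>R K x" for x
  proof (cases "\<exists>g\<in>G0. x \<in> cell a h g")
    case False
    then have "L x = 0" by (auto simp: L_def)
    then show ?thesis using K01(1) by simp
  next
    case True
    then obtain g where g: "g \<in> G0" "x \<in> cell a h g" by blast
    have xQ: "x \<in> cube a l" using cell_subset_cube[OF h, of g N a] g G0(1) by (auto simp: l)
    have finG0: "finite G0" using G0(1) finite_grid finite_subset by blast
    have other: "x \<notin> cell a h g'" if "g' \<in> G0 - {g}" for g'
      using cell_unique[OF h g(2), of g'] that by blast
    have "L x = H * (1 - d h E (\<phi> g)) / V * indicat_real (cell a h g \<inter> E) x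
      + H * d h E (\<phi> g) / V * indicat_real (cell a h g - E) x"
      unfolding L_def using other by (subst sum.remove[OF finG0 g(1)]) (simp add: sum.neutral)
    also have "\<dots> = (if x \<in> E then measure lebesgue (cell a h (\<phi> g) - E)
        else measure lebesgue (cell a h (\<phi> g) \<inter> E)) / V"
      using g(2) by (simp add: mE mD)
    also have "\<dots> \<le> J x / V"
    proof -
      have "cell a h (\<phi> g) \<subseteq> A x"
        using cell_subset_cube[OF h G0(2)[OF g(1)], of a] sep[OF g]
        by (auto simp: A_def mem_cube_annulus l)
      then have "measure lebesgue (cell a h (\<phi> g) - E) \<le> measure lebesgue (A x - E)"
        "measure lebesgue (cell a h (\<phi> g) \<inter> E) \<le> measure lebesgue (A x \<inter> E)"
        using A[of x] E cE by (auto intro!: measure_mono_fmeasurable fmeasurable_Diff fmeasurable_Int_fmeasurable)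
      then show ?thesis using V0 by (simp add: J_def divide_right_mono)
    qed
    also have "\<dots> \<le> K x" by (rule KJ)
    finally show ?thesis using xQ by simp
  qed
  have "H\<^sup>2 / V * (\<Sum>g\<in>G0. disagree (d h E g) (d h E (\<phi> g)))
      = (\<Sum>g\<in>G0. H * (1 - d h E (\<phi> g)) / V * (H * d h E g) + H * d h E (\<phi> g) / V * (H * (1 - d h E g)))"
    unfolding sum_distrib_left disagree_def
    using V0 by (intro sum.cong refl) (simp add: power2_eq_square field_simps)
  also have "\<dots> = integral\<^sup>L lebesgue L"
    using hb by (simp add: has_bochner_integral_integral_eq)
  also have "\<dots> \<le> (\<integral>x. indicator (cube a l) x *\<^sub>R K x \<partial>lebesgue)"
    using hb K_int LK by (intro integral_mono) (auto simp: has_bochner_integral_iff)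
  also have "\<dots> = (LINT x:cube a l|lebesgue. 1 / measure lebesgue (cube_annulus a l k x) *
         (LINT y:cube_annulus a l k x|lebesgue. \<bar>indicat_real E x - indicat_real E y\<bar>))"
    unfolding annulus_integral_abs_diff_indicator[OF E] unfolding set_lebesgue_integral_def K_def J_def A_def ..
  finally show ?thesis by (simp add: H_def V_def)
qed

text \<open>The outer radius is \<open>m\<close> cell sides with \<open>m = 2 * n + 8\<close>, where
  \<open>n\<close> is the dimension. A gap of at least \<open>n + 5\<close> keeps the distance above
  \<open>n + 4\<close> sides or equal to it, and a gap of at most \<open>n + 7\<close> keeps it
  below \<open>2 * n + 7\<close> sides. Three consecutive gaps are thus admissible.\<close>

lemma annulus_condition:
  fixes x y a :: "real ^ 'n"
  defines "m \<equiv> 2 * CARD('n) + 8"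
  assumes "h > 0" and l: "l = h * real (2 ^ k * m)"
    and "x \<in> cell a h g" "y \<in> cell a h (g(i := v))"
    and gv: "real CARD('n) + 5 \<le> \<bar>real (g i) - real v\<bar>" "\<bar>real (g i) - real v\<bar> \<le> real CARD('n) + 7"
  shows "l / 2 ^ k / 2 \<le> dist x y \<and> dist x y < l / 2 ^ k"
proof
  note b = cell_dist_bounds[OF assms(2) assms(4,5)]
  have r: "l / 2 ^ k = h * (2 * real CARD('n) + 8)" by (simp add: l m_def)
  have "l / 2 ^ k / 2 = h * (real CARD('n) + 5 - 1)" by (simp add: r algebra_simps)
  also have "\<dots> \<le> h * (\<bar>real (g i) - real v\<bar> - 1)" using gv(1) \<open>h > 0\<close> by (intro mult_left_mono) auto
  finally show "l / 2 ^ k / 2 \<le> dist x y" using b(1) by linarith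
  have "h * (\<bar>real (g i) - real v\<bar> + real CARD('n)) \<le> h * (2 * real CARD('n) + 8)"
    using gv(2) \<open>h > 0\<close> by (intro mult_left_mono) auto
  with b(2) show "dist x y < l / 2 ^ k" unfolding r by linarith
qed

section \<open>The oscillation estimate\<close>

text \<open>Here \<open>P\<close> plays the role of \<open>2 powr (k + s)\<close> and
  \<open>Y\<close> of the normalised annulus integral. The first case uses \<open>Pn\<close> to
  trade \<open>\<delta> powr p\<close> for \<open>P * \<delta>\<close>; in the second
  \<open>Y\<close> is bounded below; in the third, cancelling \<open>N ^ (n - 1)\<close> leaves one
  factor \<open>N = 2 ^ k * m\<close>, absorbed by \<open>P\<close>.\<close>

lemma powr_le_of_density_cases:
  fixes \<delta> P Y \<kappa> :: real and n m k :: nat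
  defines "p \<equiv> (real n - 1) / real n" and "N \<equiv> 2 ^ k * m"
  assumes n: "n \<ge> 1" and m: "m \<ge> 1" and \<kappa>: "0 < \<kappa>" "\<kappa> \<le> 1" and Y: "0 \<le> 2 * Y * real N ^ n"
    and \<delta>: "0 < \<delta>" "\<delta> \<le> 1/2" and P1: "1 \<le> P" and Pk: "2 ^ k \<le> P" and Pn: "1 \<le> P powr real n * \<delta>"
    and cases: "\<delta> * real N ^ n / 2 \<le> 2 * Y * real N ^ n \<or> real N ^ n / 4 \<le> 2 * Y * real N ^ n
      \<or> \<kappa> / 2 * (\<delta> * real N ^ n / 2) powr p \<le> 2 * Y * real N ^ n"
  shows "\<delta> powr p \<le> 8 * real m / \<kappa> * P * Y"
proof -
  have p: "0 \<le> p" "p \<le> 1" using n by (auto simp: p_def)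
  have N0: "real N > 0" using m by (simp add: N_def)
  have NN: "real N ^ n > 0" using N0 by simp
  have Y0: "0 \<le> Y"
    using Y NN by (metis mult_less_0_iff not_less zero_less_numeral)
  have C: "8 * (P * Y) \<le> 8 * real m / \<kappa> * P * Y"
  proof -
    have "1 \<le> real m / \<kappa>" using \<kappa> m by simp
    then show ?thesis using mult_right_mono[of 1 "real m / \<kappa>" "8 * (P * Y)"] P1 Y0 by (simp add: mult_ac)
  qed
  have YPY: "Y \<le> P * Y" using P1 Y0 mult_right_mono[of 1 P Y] by simp
  show ?thesis
    using cases
  proof (elim disjE)
    have "1 powr (1 / real n) \<le> (P powr real n * \<delta>) powr (1 / real n)"
      using Pn by (intro powr_mono2) auto
    also have "\<dots> = P * \<delta> powr (1 / real n)"
      using P1 \<delta>(1) n by (simp add: powr_mult powr_powr)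
    finally have "\<delta> powr p * 1 \<le> \<delta> powr p * (P * \<delta> powr (1 / real n))"
      by (intro mult_left_mono) auto
    also have "\<dots> = P * (\<delta> powr p * \<delta> powr (1 / real n))" by simp
    also have "\<delta> powr p * \<delta> powr (1 / real n) = \<delta>"
      using \<delta>(1) n by (simp add: p_def diff_divide_distrib flip: powr_add)
    finally have P\<delta>: "\<delta> powr p \<le> P * \<delta>" by simp
    assume "\<delta> * real N ^ n / 2 \<le> 2 * Y * real N ^ n"
    then have "\<delta> * real N ^ n \<le> (4 * Y) * real N ^ n" by simp
    then have "\<delta> \<le> 4 * Y" by (rule mult_right_le_imp_le) (rule NN)
    then have "P * \<delta> \<le> P * (8 * Y)" using P1 Y0 by (intro mult_left_mono) auto
    with P\<delta> C show ?thesis by (simp add: mult_ac)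
  next
    assume "real N ^ n / 4 \<le> 2 * Y * real N ^ n"
    then have "1 * real N ^ n \<le> (8 * Y) * real N ^ n" by simp
    then have "1 \<le> 8 * Y" by (rule mult_right_le_imp_le) (rule NN)
    moreover have "\<delta> powr p \<le> 1" using \<delta> p by (intro powr_le1) auto
    ultimately show ?thesis using C YPY by linarith
  next
    assume 3: "\<kappa> / 2 * (\<delta> * real N ^ n / 2) powr p \<le> 2 * Y * real N ^ n"
    have "\<delta> powr p / 2 \<le> (\<delta> / 2) powr p"
    proof -
      have "2 powr p \<le> (2::real)" using powr_mono[of p 1 2] p by simp
      then have "\<delta> powr p / 2 \<le> \<delta> powr p / 2 powr p" by (intro divide_left_mono) auto
      then show ?thesis using \<delta>(1) by (simp only: powr_divide less_imp_le zero_le_numeral)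
    qed
    then have "\<kappa> / 2 * (\<delta> powr p / 2 * real N ^ (n - 1)) \<le> \<kappa> / 2 * ((\<delta> / 2) powr p * real N ^ (n - 1))"
      using \<kappa> by (intro mult_left_mono mult_right_mono) auto
    also have "(\<delta> / 2) powr p * real N ^ (n - 1) = (\<delta> * real N ^ n / 2) powr p"
    proof -
      have "(real N ^ n) powr p = real N powr (real n * p)"
        using N0 by (simp add: powr_powr flip: powr_realpow)
      also have "real n * p = real (n - 1)" using n by (simp add: p_def of_nat_diff)
      also have "real N powr real (n - 1) = real N ^ (n - 1)" using N0 by (rule powr_realpow)
      finally show ?thesis using \<delta>(1) by (simp add: powr_mult powr_divide)
    qed
    also note 3
    also have "real N ^ n = real N * real N ^ (n - 1)" using n by (simp add: power_eq_if)
    finally have "(\<kappa> * \<delta> powr p) * real N ^ (n - 1) \<le> (8 * Y * real N) * real N ^ (n - 1)"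
      by (simp add: mult_ac)
    then have "\<kappa> * \<delta> powr p \<le> 8 * Y * real N"
      by (rule mult_right_le_imp_le) (use N0 in simp)
    also have "\<dots> \<le> 8 * Y * (P * real m)"
      using Pk Y0 by (intro mult_left_mono) (auto simp: N_def intro: mult_right_mono)
    finally show ?thesis using \<kappa>(1) by (simp add: field_simps)
  qed
qed

theorem lemma3p3:
  "\<exists>C::real. \<forall>(a :: real ^ 'n) (l::real) (E :: (real ^ 'n) set) (k::nat) (s::real).
     l > 0 \<longrightarrow> E \<in> sets lebesgue \<longrightarrow> k \<ge> 1 \<longrightarrow> s \<ge> 0 \<longrightarrow>
     1 / 2 powr ((real k + s) * real CARD('n))
       \<le> measure lebesgue (cube a l \<inter> E) / measure lebesgue (cube a l) \<longrightarrow>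
     measure lebesgue (cube a l \<inter> E) / measure lebesgue (cube a l) \<le> 1 / 2 \<longrightarrow>
     (measure lebesgue (cube a l \<inter> E) / measure lebesgue (cube a l))
         powr ((real CARD('n) - 1) / real CARD('n))
       \<le> C * 2 powr (real k + s) * (1 / measure lebesgue (cube a l)) *
         (LINT x:cube a l|lebesgue.
            1 / measure lebesgue (cube_annulus a l k x) *
            (LINT y:cube_annulus a l k x|lebesgue.
               \<bar>indicat_real E x - indicat_real E y\<bar>))"
proof -
  define n where "n = CARD('n)"
  \<comment> \<open>\<open>m\<close> is the number of cell sides in the outer radius,
    \<open>c\<close> the ratio of the annulus volume bound to the cell volume, and
    \<open>\<kappa>\<close> the isoperimetric constant.\<close>
  define m where "m = 2 * n + 8"
  define c where "c = (2 * real m) ^ n"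
  define \<kappa> where "\<kappa> = 1 - (3/4) powr (1 / real n)"
  define C where "C = 8 * c * real m / \<kappa>"
  have n: "n \<ge> 1" by (simp add: n_def Suc_leI)
  have m: "m > 0" by (simp add: m_def)
  have c0: "c > 0" using m by (simp add: c_def)
  have "(3/4 :: real) powr (1 / real n) < 1 powr (1 / real n)"
    using n by (intro powr_less_mono2) auto
  then have \<kappa>: "0 < \<kappa>" "\<kappa> \<le> 1" by (auto simp: \<kappa>_def)
  show ?thesis
  proof (intro exI[of _ C] allI impI)
    fix a :: "real ^ 'n" and l :: real and E :: "(real ^ 'n) set" and k :: nat and s :: real
    assume l0: "l > 0" and E: "E \<in> sets lebesgue" and k: "k \<ge> 1" and s: "s \<ge> 0"
    define \<delta> where "\<delta> = measure lebesgue (cube a l \<inter> E) / measure lebesgue (cube a l)"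
    assume "1 / 2 powr ((real k + s) * real CARD('n))
        \<le> measure lebesgue (cube a l \<inter> E) / measure lebesgue (cube a l)"
      and "measure lebesgue (cube a l \<inter> E) / measure lebesgue (cube a l) \<le> 1 / 2"
    then have \<delta>: "1 / 2 powr ((real k + s) * real n) \<le> \<delta>" "\<delta> \<le> 1/2" by (simp_all add: \<delta>_def n_def)
    define I where "I = (LINT x:cube a l|lebesgue. 1 / measure lebesgue (cube_annulus a l k x) *
            (LINT y:cube_annulus a l k x|lebesgue. \<bar>indicat_real E x - indicat_real E y\<bar>))"
    define N where "N = 2 ^ k * m"
    define h where "h = l / real N"
    define H where "H = h ^ n"
    define d where "d g = measure lebesgue (cell a h g \<inter> E) / h ^ CARD('n)" for g
    \<comment> \<open>As \<open>H\<close> is \<open>l ^ n / N ^ n\<close>, \<open>X / 2\<close>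
      equals \<open>c * I / H\<close>, the bound for pairs seen directly through the annulus. The
      factor 2 pays for going through a third cell.\<close>
    define Y where "Y = c * I / l ^ n"
    define X where "X = 2 * Y * real N ^ n"
    have N0: "N > 0" using m by (simp add: N_def)
    have h0: "h > 0" using l0 N0 by (simp add: h_def)
    have l: "l = h * real N" using N0 by (simp add: h_def)
    have H0: "H > 0" using h0 by (simp add: H_def)
    have d01: "0 \<le> d g" "d g \<le> 1" for g
    proof -
      have "measure lebesgue (cell a h g \<inter> E) \<le> measure lebesgue (cell a h g)"
        using E by (intro measure_mono_fmeasurable) auto
      then show "0 \<le> d g" "d g \<le> 1" using h0 by (auto simp: d_def measure_cell)
    qed
    have D: "(\<Sum>g\<in>grid N. d g) = \<delta> * real N ^ n"
    proof -
      have "(\<Sum>g\<in>grid N. d g) = measure lebesgue (cube a l \<inter> E) / H"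
        unfolding d_def l measure_cube_Int_eq_sum_cells[OF h0 E] by (simp add: H_def n_def sum_divide_distrib)
      also have "\<dots> = \<delta> * real N ^ n"
        using l0 H0 N0 by (simp add: \<delta>_def measure_cube n_def[symmetric]) (simp add: l H_def power_mult_distrib)
      finally show ?thesis .
    qed
    have bound: "(\<Sum>g\<in>G0. disagree (d g) (d (\<phi> g))) \<le> X / 2"
      if "G0 \<subseteq> grid N" "\<And>g. g \<in> G0 \<Longrightarrow> \<phi> g \<in> grid N"
        and step: "\<And>g. g \<in> G0 \<Longrightarrow> \<exists>i v. \<phi> g = g(i := v) \<and> real n + 5 \<le> \<bar>real (g i) - real v\<bar>
          \<and> \<bar>real (g i) - real v\<bar> \<le> real n + 7" for G0 \<phi>
    proof -
      have "(h ^ n)\<^sup>2 / (2 * (l / 2 ^ k)) ^ n * (\<Sum>g\<in>G0. disagree (d g) (d (\<phi> g))) \<le> I"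
        unfolding d_def I_def n_def
      proof (rule annulus_average_ge_sum_disagree[OF h0 N0 l E that(1,2)])
        fix g x y assume g: "g \<in> G0" "x \<in> cell a h g" "y \<in> cell a h (\<phi> g)"
        from step[OF g(1)] obtain i v where "\<phi> g = g(i := v)"
          "real n + 5 \<le> \<bar>real (g i) - real v\<bar>" "\<bar>real (g i) - real v\<bar> \<le> real n + 7" by blast
        then show "l / 2 ^ k / 2 \<le> dist x y \<and> dist x y < l / 2 ^ k"
          using annulus_condition[OF h0 _ g(2), of l k y i v] g(3) l by (simp add: N_def m_def n_def)
      qed
      moreover have "(h ^ n)\<^sup>2 / (2 * (l / 2 ^ k)) ^ n = H / c"
      proof -
        have "2 * (l / 2 ^ k) = (2 * real m) * h" by (simp add: l N_def)
        then have "(2 * (l / 2 ^ k)) ^ n = c * H" by (simp only: c_def H_def power_mult_distrib)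
        then show ?thesis using H0 by (simp add: H_def power2_eq_square)
      qed
      ultimately have "H / c * (\<Sum>g\<in>G0. disagree (d g) (d (\<phi> g))) \<le> I" by (simp only:)
      then have "(\<Sum>g\<in>G0. disagree (d g) (d (\<phi> g))) \<le> c * I / H"
        using H0 c0 by (simp add: field_simps)
      also have "\<dots> = X / 2"
        using H0 N0 by (simp add: X_def Y_def) (simp add: l H_def power_mult_distrib)
      finally show ?thesis .
    qed
    \<comment> \<open>Cells whose indices differ by between \<open>n + 5\<close> and \<open>n + 7\<close> in one coordinate see each other
      through the annulus. Hence a cell jumping by \<open>n + 6\<close> lands on one that sees both itself and its
      neighbour, and the triangle inequality passes to equal and adjacent cells.\<close>
    define t where "t = n + 6"
    \<comment> \<open>Jump upwards if there is room, otherwise downwards. Then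
      \<open>g i + t \<ge> N \<ge> 2 * t\<close>, so the natural subtraction does not
      truncate.\<close>
    define jump where "jump i g = (if g i + t < N then g i + t else g i - t)" for i :: 'n and g
    define w where "w i g = g(i := jump i g)" for i :: 'n and g
    \<comment> \<open>The assumption \<open>k \<ge> 1\<close> makes the grid wide enough for a jump
      in one of the two directions.\<close>
    have "(2::nat) ^ 1 \<le> 2 ^ k" using k by (rule power_increasing) simp
    then have "2 * m \<le> N" unfolding N_def by (intro mult_le_mono1) simp
    then have N2: "2 * t \<le> N" by (simp add: m_def t_def)
    have jump: "\<bar>real (g i) - real (jump i g)\<bar> = real n + 6"
      "\<bar>real (Suc (g i)) - real (jump i g)\<bar> \<in> {real n + 5, real n + 7}" for i g
    proof -
      \<comment> \<open>Seen from the neighbour \<open>Suc (g i)\<close>, an upward jump has gap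
        \<open>n + 5\<close> and a downward jump \<open>n + 7\<close>.\<close>
      consider "real (jump i g) = real (g i) + real t" | "real (jump i g) = real (g i) - real t"
        using N2 by (cases "g i + t < N") (auto simp: jump_def of_nat_diff)
      then show "\<bar>real (g i) - real (jump i g)\<bar> = real n + 6"
        "\<bar>real (Suc (g i)) - real (jump i g)\<bar> \<in> {real n + 5, real n + 7}"
        by (cases; simp add: t_def)+
    qed
    have w_grid: "w i g \<in> grid N" if "g \<in> grid N" for i g
    proof -
      have "g i < N" using that by (simp add: grid_def)
      then have "jump i g < N" by (auto simp: jump_def)
      then show ?thesis unfolding w_def by (rule fun_upd_in_grid[OF that])
    qed
    have bound1: "(\<Sum>g\<in>G0. disagree (d g) (d (w i g))) \<le> X / 2" if "G0 \<subseteq> grid N" for G0 i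
    proof (rule bound[OF that])
      fix g assume "g \<in> G0"
      then show "w i g \<in> grid N" using that w_grid by blast
      show "\<exists>j v. w i g = g(j := v) \<and> real n + 5 \<le> \<bar>real (g j) - real v\<bar> \<and> \<bar>real (g j) - real v\<bar> \<le> real n + 7"
        using jump(1)[of g i] by (intro exI[of _ i] exI[of _ "jump i g"]) (simp add: w_def)
    qed
    have "(\<Sum>g\<in>grid N. disagree (d g) (d g)) \<le> (\<Sum>g\<in>grid N. 2 * disagree (d g) (d (w i g)))" for i
    proof (rule sum_mono)
      fix g
      show "disagree (d g) (d g) \<le> 2 * disagree (d g) (d (w i g))"
        using disagree_triangle[of "d g" "d g" "d (w i g)"] d01 disagree_commute[of "d g" "d (w i g)"] by simp
    qed
    \<comment> \<open>Any direction serves for equal cells; \<open>undefined\<close> is an arbitrary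
      coordinate.\<close>
    from this[of undefined] have X0: "(\<Sum>g\<in>grid N. disagree (d g) (d g)) \<le> X"
      using bound1[OF order_refl, of undefined] unfolding sum_distrib_left[symmetric] by linarith
    have X1: "(\<Sum>g\<in>{g\<in>grid N. g i + 1 < N}. disagree (d g) (d (g(i := g i + 1)))) \<le> X" for i
    proof -
      let ?G = "{g\<in>grid N. g i + 1 < N}"
      define sh where "sh g = g(i := g i + 1)" for g :: "'n \<Rightarrow> nat"
      \<comment> \<open>The second sum below is reindexed so that the neighbour becomes the starting
        cell required by \<open>bound\<close>. As a left inverse of \<open>sh\<close>,
        \<open>sh'\<close> undoes an addition and never truncates.\<close>
      define sh' where "sh' g = g(i := g i - 1)" for g :: "'n \<Rightarrow> nat"
      have inv: "sh' (sh g) = g" for g by (simp add: sh_def sh'_def)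
      have inj: "inj_on sh ?G" by (rule inj_on_inverseI[where g = sh']) (rule inv)
      have "(\<Sum>g\<in>?G. disagree (d g) (d (sh g)))
          \<le> (\<Sum>g\<in>?G. disagree (d g) (d (w i g)) + disagree (d (sh g)) (d (w i g)))"
      proof (rule sum_mono)
        fix g
        show "disagree (d g) (d (sh g)) \<le> disagree (d g) (d (w i g)) + disagree (d (sh g)) (d (w i g))"
          using disagree_triangle[of "d g" "d (sh g)" "d (w i g)"] d01 disagree_commute[of "d (sh g)" "d (w i g)"]
          by simp
      qed
      also have "\<dots> = (\<Sum>g\<in>?G. disagree (d g) (d (w i g))) + (\<Sum>g\<in>?G. disagree (d (sh g)) (d (w i g)))"
        by (rule sum.distrib)
      also have "(\<Sum>g\<in>?G. disagree (d (sh g)) (d (w i g)))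
          = (\<Sum>g\<in>sh ` ?G. disagree (d g) (d (w i (sh' g))))"
        unfolding sum.reindex[OF inj] comp_def inv ..
      also have "\<dots> \<le> X / 2"
      proof (rule bound)
        show "sh ` ?G \<subseteq> grid N" by (auto simp: sh_def intro: fun_upd_in_grid)
        fix g' assume "g' \<in> sh ` ?G"
        then obtain g where g: "g \<in> grid N" "g' = sh g" by blast
        then show "w i (sh' g') \<in> grid N" by (simp add: inv w_grid)
        have "w i (sh' g') = g'(i := jump i g)"
          unfolding g(2) inv by (simp add: w_def sh_def)
        then show "\<exists>j v. w i (sh' g') = g'(j := v) \<and> real n + 5 \<le> \<bar>real (g' j) - real v\<bar>
            \<and> \<bar>real (g' j) - real v\<bar> \<le> real n + 7"
          using jump(2)[of g i] by (intro exI[of _ i] exI[of _ "jump i g"]) (auto simp: g(2) sh_def)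
      qed
      also have "(\<Sum>g\<in>?G. disagree (d g) (d (w i g))) \<le> X / 2" by (rule bound1) auto
      finally show ?thesis unfolding sh_def by linarith
    qed
    \<comment> \<open>The sign of \<open>Y\<close> follows from \<open>X0\<close>, without a
      separate argument for the integral.\<close>
    have "0 \<le> (\<Sum>g\<in>grid N. disagree (d g) (d g))" by (intro sum_nonneg disagree_nonneg d01)
    then have Y: "0 \<le> 2 * Y * real N ^ n" using X0 by (simp only: X_def)
    define p where "p = (real n - 1) / real n"
    define P where "P = 2 powr (real k + s)"
    have \<delta>0: "0 < \<delta>" by (rule less_le_trans[OF _ \<delta>(1)]) simp
    have P1: "1 \<le> P" unfolding P_def using s by (intro ge_one_powr_ge_zero) auto
    have Pk: "2 ^ k \<le> P"
      unfolding P_def using s powr_mono[of "real k" "real k + s" 2] by (simp add: powr_realpow)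
    have Pn: "1 \<le> P powr real n * \<delta>"
      \<comment> \<open>This is the lower density bound of the theorem, with its parameter
        \<open>s\<close>, rewritten in terms of \<open>P\<close>.\<close>
      using \<delta>(1) by (simp add: P_def powr_powr divide_le_eq mult.commute)
    have half: "(\<Sum>g\<in>grid N. d g) \<le> real N ^ CARD('n) / 2"
      unfolding D n_def[symmetric] using \<delta>(2) mult_right_mono[of \<delta> "1/2" "real N ^ n"] by simp
    have "\<delta> powr p \<le> 8 * real m / \<kappa> * P * Y"
      unfolding p_def
    proof (rule powr_le_of_density_cases[OF n _ \<kappa> _ \<delta>0 \<delta>(2) P1 Pk Pn])
      show "\<delta> * real (2 ^ k * m) ^ n / 2 \<le> 2 * Y * real (2 ^ k * m) ^ n
        \<or> real (2 ^ k * m) ^ n / 4 \<le> 2 * Y * real (2 ^ k * m) ^ n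
        \<or> \<kappa> / 2 * (\<delta> * real (2 ^ k * m) ^ n / 2) powr ((real n - 1) / real n) \<le> 2 * Y * real (2 ^ k * m) ^ n"
        using grid_density_isoperimetric[OF _ half X0 X1] d01
        unfolding D unfolding n_def[symmetric] \<kappa>_def[symmetric] N_def[symmetric] X_def[symmetric] by blast
    qed (use m Y in \<open>simp_all add: N_def\<close>)
    then have main: "\<delta> powr p \<le> C / c * P * Y" using c0 by (simp add: C_def)
    \<comment> \<open>The \<open>c\<close> in \<open>Y\<close> cancels, and the remaining
      \<open>1 / l ^ n\<close> is the normalisation by the volume of the cube.\<close>
    have "C / c * P * Y = C * P * (1 / measure lebesgue (cube a l)) * I"
      using l0 c0 by (simp add: Y_def measure_cube n_def)
    then show "(measure lebesgue (cube a l \<inter> E) / measure lebesgue (cube a l))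
         powr ((real CARD('n) - 1) / real CARD('n))
       \<le> C * 2 powr (real k + s) * (1 / measure lebesgue (cube a l)) *
         (LINT x:cube a l|lebesgue.
            1 / measure lebesgue (cube_annulus a l k x) *
            (LINT y:cube_annulus a l k x|lebesgue.
               \<bar>indicat_real E x - indicat_real E y\<bar>))"
      using main unfolding \<delta>_def p_def P_def n_def I_def by simp
  qed
qed

end
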